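(* Let $t,k,v$ be integers with $0\le t\le k\le v-t$. Then the Smith normal form of the integer matrix $W_{\overline{t}k}(v)$ is $(I\mid O)$, where $I$ is the identity matrix of order $\binom{v}{t}$ and $O$ is the $\binom{v}{t}\times\left(\binom{v}{k}-\binom{v}{t}\right)$ zero matrix.
   Context: For a positive integer $v$, $[v]=\{1,\dots,v\}$. For a finite set $F=\{a_1<a_2<\dots<a_m\}$ of positive integers define $b_1,\dots,b_m$ recursively by $b_i=\max\big([a_i]\setminus(F\cup\{b_1,\dots,b_{i-1}\})\big)$, where $\max\emptyset$ is a special symbol $\mathfrak{j}$ (and $\mathfrak{j}$ is ignored when it appears in the set $\{b_1,\dots,b_{i-1}\}$). The rank $r(F)$ is the number of indices $i$ with $b_i\neq\mathfrak{j}$; $F$ is full-rank if $r(F)=|F|$ (in particular $\emptyset$ is full-rank). If $F$ is not full-rank, let $i$ be the largest index with $b_i=\mathfrak{j}$ and set $F^-=F\setminus\{a_i\}$. For any finite $F$, $\overline{F}$ denotes the full-rank set obtained from $F$ by applying $F\mapsto F^-$ repeatedly until a full-rank set is reached. For $0\le t\le k\le v$, $W_{\overline{t}k}(v)$ is the $\binom{v}{t}\times\binom{v}{k}$ $0,1$-matrix with rows indexed by the $t$-subsets $T$ of $[v]$ and columns by the $k$-subsets $K$ of $[v]$, whose $(T,K)$ entry is $1$ iff $\overline{T}\subseteq K$. The Smith normal form of an integer matrix $A$ is the matrix $(D\mid O)$ with $D=\mathrm{diag}(d_1,\dots,d_r)$, $d_i>0$, $d_1\mid\cdots\mid d_r$,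 such that $UAV=(D\mid O)$ for some unimodular $U,V$. *)

theory Defs
  imports "Jordan_Normal_Form.Determinant"
begin

text \<open>
  The elements of a finite set \<open>F\<close> in increasing order, counted from \<open>0\<close>: \<open>elt F i\<close> is the
  \<open>a\<^sub>i\<^sub>+\<^sub>1\<close> of the usual 1-based notation \<open>F = {a\<^sub>1 < a\<^sub>2 < \<dots> < a\<^sub>m}\<close>. It is meaningful for
  \<open>i < card F\<close> only.
\<close>

definition elt :: "nat set \<Rightarrow> nat \<Rightarrow> nat" where
  "elt F i = sorted_list_of_set F ! i"

text \<open>
  \<open>None\<close> plays the role of the special symbol \<open>max \<emptyset>\<close>; \<open>Option.these\<close> drops it from
  the set of earlier values.
\<close>

fun partner :: "nat set \<Rightarrow> nat \<Rightarrow> nat option" where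
  "partner F i =
    (let S = {1..elt F i} - (F \<union> Option.these (partner F ` {..<i}))
     in if S = {} then None else Some (Max S))"

declare partner.simps [simp del]

definition set_rank :: "nat set \<Rightarrow> nat" where
  "set_rank F = card {i. i < card F \<and> partner F i \<noteq> None}"

definition full_rank :: "nat set \<Rightarrow> bool" where
  "full_rank F \<longleftrightarrow> set_rank F = card F"

definition reduce :: "nat set \<Rightarrow> nat set" where
  "reduce F = F - {elt F (Max {i. i < card F \<and> partner F i = None})}"

lemma card_reduce_less:
  assumes "\<not> full_rank F"
  shows "card (reduce F) < card F"
proof -
  let ?N = "{i. i < card F \<and> partner F i = None}"
  have "?N \<noteq> {}"
  proof
    assume "?N = {}"
    then have "{i. i < card F \<and> partner F i \<noteq> None} = {..<card F}" by auto
    then show False using assms by (simp add: full_rank_def set_rank_def)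
  qed
  then have "Max ?N \<in> ?N" by (intro Max_in) auto
  then have less: "Max ?N < card F" by simp
  then have fin: "finite F" by (metis card.infinite not_less_zero)
  have "elt F (Max ?N) \<in> F"
    using less fin nth_mem[of "Max ?N" "sorted_list_of_set F"] by (simp add: elt_def)
  then show ?thesis unfolding reduce_def by (rule card_Diff1_less[OF fin])
qed

function full_rank_part :: "nat set \<Rightarrow> nat set" where
  "full_rank_part F = (if full_rank F then F else full_rank_part (reduce F))"
  by auto
termination by (relation "measure card") (auto simp: card_reduce_less)

declare full_rank_part.simps [simp del]

text \<open>
  A listing of the \<open>s\<close>-subsets of \<open>{1, \<dots>, v}\<close>, used to index rows or columns of a matrix.
\<close>

definition enumerates_subsets :: "nat set list \<Rightarrow> nat \<Rightarrow> nat \<Rightarrow> bool" where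
  "enumerates_subsets Xs s v \<longleftrightarrow>
     distinct Xs \<and> set Xs = {X. X \<subseteq> {1..v} \<and> card X = s}"

text \<open>
  If \<open>Ts\<close> and \<open>Ks\<close> list the \<open>t\<close>-subsets and the \<open>k\<close>-subsets of \<open>{1, \<dots>, v}\<close>, this is the matrix
  usually written \<open>W\<close> with subscripts \<open>t\<close> (overlined) and \<open>k\<close>, and argument \<open>v\<close>.
\<close>

definition W_bar :: "nat set list \<Rightarrow> nat set list \<Rightarrow> int mat" where
  "W_bar Ts Ks = mat (length Ts) (length Ks)
     (\<lambda>(i, j). if full_rank_part (Ts ! i) \<subseteq> Ks ! j then 1 else 0)"

definition unimodular :: "int mat \<Rightarrow> bool" where
  "unimodular U \<longleftrightarrow> square_mat U \<and> \<bar>det U\<bar> = 1"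

text \<open>
  The blocks of zero rows are empty precisely when \<open>A\<close> has full row rank; in that case the form
  is \<open>(D | O)\<close>.
\<close>

definition is_smith_normal_form :: "int mat \<Rightarrow> int mat \<Rightarrow> bool" where
  "is_smith_normal_form A S \<longleftrightarrow>
     (\<exists>r d. r \<le> dim_row A \<and> r \<le> dim_col A
        \<and> (\<forall>i<r. d i > 0) \<and> (\<forall>i. Suc i < r \<longrightarrow> d i dvd d (Suc i))
        \<and> S = four_block_mat (mat_diag r d) (0\<^sub>m r (dim_col A - r))
                (0\<^sub>m (dim_row A - r) r) (0\<^sub>m (dim_row A - r) (dim_col A - r)))
     \<and> (\<exists>U V. U \<in> carrier_mat (dim_row A) (dim_row A) \<and> unimodular U
        \<and> V \<in> carrier_mat (dim_col A) (dim_col A) \<and> unimodular V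
        \<and> U * A * V = S)"

definition append_cols :: "int mat \<Rightarrow> int mat \<Rightarrow> int mat" where
  "append_cols A B = four_block_mat A B (0\<^sub>m 0 (dim_col A)) (0\<^sub>m 0 (dim_col B))"

end

theory Submission
  imports Defs
begin

text \<open>
  Reading the elements of \<open>F\<close> as closing and the other positions as opening brackets, full-rank
  sets satisfy the ballot condition \<open>2 |F \<inter> [x]| \<le> x\<close>, and \<open>full_rank_part\<close> is injective on
  sets of equal size. So the rows of the matrix are distinct rows of the inclusion matrix of ballot
  sets of size at most \<open>t\<close> versus \<open>k\<close>-sets. Splitting both rows and columns by membership of
  the largest point gives a block triangular shape, and induction produces \<open>v choose t\<close> columns
  on which the inclusion system is solvable over the integers. These columns form a square block
  with an integer right inverse, and column operations clear the remaining columns.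
\<close>

section \<open>Partners and reduction\<close>

lemma elt_less:
  assumes "i < j" "j < card F"
  shows "elt F i < elt F j"
  using assms strict_sorted_list_of_set[of F]
  by (simp add: elt_def sorted_wrt_iff_nth_less)

lemma elt_less_iff:
  assumes "i < card F" "j < card F"
  shows "elt F i < elt F j \<longleftrightarrow> i < j"
  by (metis assms elt_less less_asym linorder_neqE_nat)

lemma elt_mem:
  assumes "i < card F"
  shows "elt F i \<in> F"
proof -
  have "finite F" using assms by (metis card.infinite not_less_zero)
  then show ?thesis
    using assms nth_mem[of i "sorted_list_of_set F"] by (simp add: elt_def)
qed

lemma mem_eltE:
  assumes "finite F" "a \<in> F"
  obtains i where "i < card F" "elt F i = a"
  using assms by (metis elt_def in_set_conv_nth length_sorted_list_of_set set_sorted_list_of_set)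

lemma partner_SomeD:
  assumes "partner F i = Some b"
  shows "1 \<le> b" "b \<le> elt F i" "b \<notin> F" "\<And>j. j < i \<Longrightarrow> partner F j \<noteq> Some b"
proof -
  let ?S = "{1..elt F i} - (F \<union> Option.these (partner F ` {..<i}))"
  have "?S \<noteq> {}" "b = Max ?S"
    using assms by (subst (asm) partner.simps; auto simp: Let_def split: if_splits)+
  then have b: "b \<in> ?S" using Max_in[of ?S] by auto
  then show "1 \<le> b" "b \<le> elt F i" "b \<notin> F" by auto
  show "partner F j \<noteq> Some b" if "j < i" for j
  proof
    assume "partner F j = Some b"
    then have "Some b \<in> partner F ` {..<i}" using that by (metis image_eqI lessThan_iff)
    then show False using b by (auto simp: in_these_eq)
  qed
qed

lemma partner_Some_less:
  assumes "i < card F" "partner F i = Some b"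
  shows "b < elt F i"
  using partner_SomeD[OF assms(2)] elt_mem[OF assms(1)] by (metis le_neq_implies_less)

lemma partner_inj:
  assumes "partner F i = Some b" "partner F j = Some b"
  shows "i = j"
  using assms partner_SomeD(4) by (metis linorder_neqE_nat)

lemma partner_NoneD:
  assumes "partner F i = None" "1 \<le> b" "b \<le> elt F i" "b \<notin> F"
  shows "\<exists>j<i. partner F j = Some b"
proof -
  let ?S = "{1..elt F i} - (F \<union> Option.these (partner F ` {..<i}))"
  have "?S = {}"
    using assms(1) by (subst (asm) partner.simps) (auto simp: Let_def split: if_splits)
  moreover have "b \<in> {1..elt F i} - F" using assms by auto
  ultimately have "Some b \<in> partner F ` {..<i}" by (auto simp: in_these_eq)
  then show ?thesis by force
qed

lemma full_rank_partner:
  assumes "full_rank F" "i < card F"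
  obtains b where "partner F i = Some b"
proof -
  have "{i. i < card F \<and> partner F i \<noteq> None} = {..<card F}"
    using assms(1) by (intro card_subset_eq) (auto simp: full_rank_def set_rank_def)
  then show ?thesis using assms(2) that by blast
qed

text \<open>Every element of \<open>F\<close> in \<open>{1..x}\<close> has a partner, which is no
  larger, at least \<open>1\<close> and outside \<open>F\<close>. Distinct elements have distinct
  partners, so \<open>F \<inter> {1..x}\<close> injects into \<open>{1..x} - F\<close>, and these
  two sets partition \<open>x\<close> points.\<close>

lemma full_rank_ballot:
  assumes "finite F" "full_rank F"
  shows "2 * card (F \<inter> {1..x}) \<le> x"
proof -
  define P where "P a b \<longleftrightarrow> (\<exists>i<card F. elt F i = a \<and> partner F i = Some b)" for a b
  have ex: "\<exists>b. b \<in> {1..x} - F \<and> P a b" if "a \<in> F \<inter> {1..x}" for a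
  proof -
    obtain i where i: "i < card F" "elt F i = a" using mem_eltE[OF assms(1), of a] \<open>a \<in> F \<inter> {1..x}\<close> by blast
    then obtain b where b: "partner F i = Some b" using assms(2) full_rank_partner by blast
    then show ?thesis using i that partner_SomeD[OF b] by (auto simp: P_def)
  qed
  have uniq: "a = a'" if "P a b" "P a' b" for a a' b
    using that partner_inj by (auto simp: P_def)
  from ex obtain g where g: "\<And>a. a \<in> F \<inter> {1..x} \<Longrightarrow> g a \<in> {1..x} - F \<and> P a (g a)"
    by metis
  have "card (F \<inter> {1..x}) \<le> card ({1..x} - F)"
  proof (rule card_inj_on_le)
    show "inj_on g (F \<inter> {1..x})"
    proof (rule inj_onI)
      fix a a' assume "a \<in> F \<inter> {1..x}" "a' \<in> F \<inter> {1..x}" "g a = g a'"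
      then show "a = a'" using g[of a] g[of a'] uniq[of a "g a" a'] by simp
    qed
    show "g ` (F \<inter> {1..x}) \<subseteq> {1..x} - F" using g by blast
  qed simp
  moreover have "card ({1..x} - F) + card (F \<inter> {1..x}) = x"
    using card_Int_Diff[of "{1..x}" F] by (simp add: Int_commute)
  ultimately show ?thesis by simp
qed

section \<open>Injectivity of the full-rank part on sets of equal size\<close>

lemma reduceE:
  assumes "\<not> full_rank F"
  obtains i where "i < card F" "partner F i = None"
    "\<And>j. i < j \<Longrightarrow> j < card F \<Longrightarrow> partner F j \<noteq> None" "reduce F = F - {elt F i}"
proof -
  let ?N = "{i. i < card F \<and> partner F i = None}"
  have "?N \<noteq> {}"
  proof
    assume "?N = {}"
    then have "{i. i < card F \<and> partner F i \<noteq> None} = {..<card F}" by auto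
    then show False using assms by (simp add: full_rank_def set_rank_def)
  qed
  then have "Max ?N \<in> ?N" by (intro Max_in) auto
  then have "Max ?N < card F" "partner F (Max ?N) = None" by simp_all
  moreover have "partner F j \<noteq> None" if less: "Max ?N < j" and j: "j < card F" for j
  proof
    assume "partner F j = None"
    then have "j \<le> Max ?N" using j by (intro Max_ge) simp_all
    then show False using less by simp
  qed
  ultimately show ?thesis using that reduce_def by blast
qed

text \<open>
  If the deleted points \<open>a < a'\<close> differed, then counting partners strictly between them would give
  contradictory inequalities: all openings in \<open>[a, a')\<close> are matched within it in \<open>G\<close>, and all
  closings in \<open>(a, a')\<close> are matched within it in \<open>F\<close>.
\<close>

lemma reduce_eq_not_less:
  assumes F: "finite F" and G: "finite G"
    and i: "i < card F" "partner F i = None"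
      "\<And>j. i < j \<Longrightarrow> j < card F \<Longrightarrow> partner F j \<noteq> None"
    and i': "i' < card G" "partner G i' = None"
    and pos: "0 \<notin> F"
    and eq: "F - {elt F i} = G - {elt G i'}"
  shows "\<not> elt F i < elt G i'"
proof
  let ?a = "elt F i" and ?a' = "elt G i'"
  assume less: "?a < ?a'"
  define I where "I = {?a<..<?a'}"
  have "F \<inter> I = (F - {?a}) \<inter> I" by (auto simp: I_def)
  also have "\<dots> = G \<inter> I" unfolding eq by (auto simp: I_def)
  finally have FG: "F \<inter> I = G \<inter> I" .
  have aF: "?a \<in> F" using i elt_mem by blast
  have aG: "?a \<notin> G" using eq less elt_mem[OF i'(1)] by (metis Diff_iff nat_neq_iff singletonD singletonI)
  have a1: "1 \<le> ?a" using aF pos by (metis One_nat_def Suc_leI gr0I)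
  have "\<exists>b. b \<in> I - F \<and> (\<exists>j<card F. elt F j = x \<and> partner F j = Some b)" if "x \<in> F \<inter> I" for x
  proof -
    obtain j where j: "j < card F" "elt F j = x" using mem_eltE[OF F, of x] \<open>x \<in> F \<inter> I\<close> by blast
    then have ij: "i < j" using that elt_less_iff[OF i(1) j(1)] by (auto simp: I_def)
    then obtain b where b: "partner F j = Some b" using i(3) j by blast
    \<comment> \<open>Since \<open>?a\<close> has no partner in \<open>F\<close>, every opening
      below it is used by an index before \<open>i\<close>. A later index must therefore find its
      partner above \<open>?a\<close>, that is, inside \<open>I\<close>.\<close>
    have "\<not> b \<le> ?a"
    proof
      assume "b \<le> ?a"
      then obtain l where "l < i" "partner F l = Some b"
        using partner_NoneD[OF i(2)] partner_SomeD[OF b] by blast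
      then show False using ij partner_SomeD(4)[OF b] by (meson less_trans)
    qed
    moreover have "b < ?a'" using partner_SomeD(2)[OF b] j that by (simp add: I_def)
    ultimately have "b \<in> I - F" using partner_SomeD(3)[OF b] by (simp add: I_def)
    then show ?thesis using b j by blast
  qed
  then obtain g where g: "\<And>x. x \<in> F \<inter> I \<Longrightarrow>
      g x \<in> I - F \<and> (\<exists>j<card F. elt F j = x \<and> partner F j = Some (g x))" by metis
  have "inj_on g (F \<inter> I)"
  proof (rule inj_onI)
    fix x y assume "x \<in> F \<inter> I" "y \<in> F \<inter> I" "g x = g y"
    then show "x = y" using g[of x] g[of y] partner_inj by (metis (no_types))
  qed
  then have le1: "card (F \<inter> I) \<le> card (I - F)"
    using g by (intro card_inj_on_le[of g]) (auto simp: I_def)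
  \<comment> \<open>The point \<open>?a\<close> was deleted from \<open>F\<close> and so is missing
    from \<open>G\<close> too, which makes it an opening for \<open>G\<close>. This one extra
    opening produces the \<open>Suc\<close> that contradicts \<open>le1\<close>. Each such
    \<open>b\<close> is taken by an index before \<open>i'\<close> because \<open>?a'\<close> has no
    partner in \<open>G\<close>.\<close>
  have "\<exists>x. x \<in> G \<inter> I \<and> (\<exists>j<card G. elt G j = x \<and> partner G j = Some b)"
    if "b \<in> insert ?a (I - G)" for b
  proof -
    have b: "b \<notin> G" "?a \<le> b" "b < ?a'" using that aG less by (auto simp: I_def)
    then obtain j where j: "j < i'" "partner G j = Some b"
      using partner_NoneD[OF i'(2), of b] a1 by auto
    then have jc: "j < card G" using i' by simp
    have "b < elt G j" using partner_Some_less[OF jc j(2)] .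
    moreover have "elt G j < ?a'" using j i' elt_less by blast
    ultimately show ?thesis using b j jc elt_mem[OF jc] by (auto simp: I_def)
  qed
  then obtain h where h: "\<And>b. b \<in> insert ?a (I - G) \<Longrightarrow>
      h b \<in> G \<inter> I \<and> (\<exists>j<card G. elt G j = h b \<and> partner G j = Some b)" by metis
  have "inj_on h (insert ?a (I - G))"
  proof (rule inj_onI)
    fix x y assume "x \<in> insert ?a (I - G)" "y \<in> insert ?a (I - G)" "h x = h y"
    then obtain j l where "j < card G" "l < card G" "elt G j = elt G l"
      "partner G j = Some x" "partner G l = Some y" using h[of x] h[of y] by (metis (no_types))
    moreover from this have "j = l" using elt_less_iff by (metis less_irrefl linorder_neqE_nat)
    ultimately show "x = y" by simp
  qed
  then have "card (insert ?a (I - G)) \<le> card (G \<inter> I)"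
    using h G by (intro card_inj_on_le[of h]) auto
  then have "Suc (card (I - G)) \<le> card (G \<inter> I)" by (simp add: I_def)
  moreover have "I - G = I - F" using FG by auto
  ultimately show False using le1 FG by simp
qed

text \<open>By the preceding lemma, used in both directions, the deleted points coincide; putting
  the common point back recovers both sets.\<close>

lemma reduce_inj:
  assumes "finite F" "finite G" "0 \<notin> F" "0 \<notin> G"
    and "\<not> full_rank F" "\<not> full_rank G" "reduce F = reduce G"
  shows "F = G"
proof -
  obtain i where i: "i < card F" "partner F i = None"
      "\<And>j. i < j \<Longrightarrow> j < card F \<Longrightarrow> partner F j \<noteq> None" and ri: "reduce F = F - {elt F i}"
    using reduceE[OF assms(5)] by metis
  obtain j where j: "j < card G" "partner G j = None"
      "\<And>l. j < l \<Longrightarrow> l < card G \<Longrightarrow> partner G l \<noteq> None" and rj: "reduce G = G - {elt G j}"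
    using reduceE[OF assms(6)] by metis
  have eq: "F - {elt F i} = G - {elt G j}" using ri rj assms(7) by simp
  have "\<not> elt F i < elt G j" using reduce_eq_not_less[OF assms(1,2) i j(1,2) assms(3) eq] .
  moreover have "\<not> elt G j < elt F i"
    using reduce_eq_not_less[OF assms(2,1) j i(1,2) assms(4) eq[symmetric]] .
  ultimately have "elt F i = elt G j" by simp
  then show ?thesis using eq elt_mem[OF i(1)] elt_mem[OF j(1)] by (metis insert_Diff)
qed

lemma full_rank_full_rank_part: "full_rank (full_rank_part F)"
  by (induction F rule: full_rank_part.induct) (subst full_rank_part.simps, auto)

lemma full_rank_part_subset: "full_rank_part F \<subseteq> F"
proof (induction F rule: full_rank_part.induct)
  case (1 F)
  then show ?case by (subst full_rank_part.simps) (auto simp: reduce_def)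
qed

lemma card_reduce:
  assumes "\<not> full_rank F"
  shows "Suc (card (reduce F)) = card F"
proof -
  obtain i where i: "i < card F" "reduce F = F - {elt F i}" using reduceE[OF assms] by metis
  then have "finite F" by (metis card.infinite not_less_zero)
  then show ?thesis using i elt_mem[OF i(1)] card_Suc_Diff1 by metis
qed

lemma card_full_rank_part_less:
  assumes "finite F" "\<not> full_rank F"
  shows "card (full_rank_part F) < card F"
proof -
  have "full_rank_part F = full_rank_part (reduce F)"
    using assms by (subst full_rank_part.simps) simp
  then have "card (full_rank_part F) \<le> card (reduce F)"
    using assms full_rank_part_subset[of "reduce F"] by (intro card_mono) (auto simp: reduce_def)
  then show ?thesis using card_reduce_less[OF assms(2)] by simp
qed

lemma full_rank_part_inj:
  assumes "finite F" "finite G" "0 \<notin> F" "0 \<notin> G" "card F = card G"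
    and "full_rank_part F = full_rank_part G"
  shows "F = G"
  using assms
proof (induction F arbitrary: G rule: full_rank_part.induct)
  case (1 F)
  \<comment> \<open>A full-rank set is its own full-rank part, while any other finite set has a
    strictly smaller one. Equal sizes and equal full-rank parts exclude the mixed case.\<close>
  have iff: "full_rank F \<longleftrightarrow> full_rank G"
    using "1.prems" card_full_rank_part_less[of F] card_full_rank_part_less[of G]
    by (metis full_rank_part.simps less_irrefl)
  show ?case
  proof (cases "full_rank F")
    case True
    then show ?thesis using iff "1.prems"(6) by (metis full_rank_part.simps)
  next
    case False
    then have nG: "\<not> full_rank G" using iff by simp
    have "reduce F = reduce G"
    proof (rule "1.IH"[OF False])
      show "full_rank_part (reduce F) = full_rank_part (reduce G)"
        using False nG "1.prems"(6) by (metis full_rank_part.simps)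
      show "card (reduce F) = card (reduce G)"
        using card_reduce[OF False] card_reduce[OF nG] "1.prems"(5) by simp
    qed (use "1.prems" in \<open>auto simp: reduce_def\<close>)
    then show ?thesis using reduce_inj False nG "1.prems" by blast
  qed
qed

section \<open>Integer solvability of the inclusion system\<close>

definition ballot_sets :: "nat \<Rightarrow> nat \<Rightarrow> nat set set" where
  "ballot_sets v t = {T. T \<subseteq> {1..v} \<and> card T \<le> t \<and> (\<forall>x. 2 * card (T \<inter> {1..x}) \<le> x)}"

text \<open>The entry at row \<open>T\<close> of the inclusion matrix with column set
  \<open>C\<close> times the coefficient vector \<open>x\<close>.\<close>

definition incl_sum :: "'a set set \<Rightarrow> ('a set \<Rightarrow> int) \<Rightarrow> 'a set \<Rightarrow> int" where
  "incl_sum C x T = (\<Sum>K | K \<in> C \<and> T \<subseteq> K. x K)"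

text \<open>Surjectivity over the integers of the inclusion matrix with rows \<open>\<T>\<close> and
  columns \<open>C\<close>. Working with functions on sets avoids block matrices with ordered
  indices in the induction.\<close>

definition solvable_on :: "'a set set \<Rightarrow> 'a set set \<Rightarrow> bool" where
  "solvable_on C \<T> \<longleftrightarrow> (\<forall>f. \<exists>x. \<forall>T\<in>\<T>. incl_sum C x T = f T)"

lemma solvable_onD:
  assumes "solvable_on C \<T>"
  obtains x where "\<And>T. T \<in> \<T> \<Longrightarrow> incl_sum C x T = f T"
  using assms unfolding solvable_on_def by metis

lemma solvable_on_mono: "solvable_on C \<T> \<Longrightarrow> \<S> \<subseteq> \<T> \<Longrightarrow> solvable_on C \<S>"
  unfolding solvable_on_def by blast

text \<open>The block shape of the split at \<open>n\<close>: rows \<open>T\<close> read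
  \<open>(W1 | W2)\<close> and rows \<open>insert n T\<close> read \<open>(0 | W2)\<close>, because
  a set avoiding \<open>n\<close> cannot contain \<open>insert n T\<close>. The vector is
  \<open>x1\<close> on columns without \<open>n\<close> and \<open>x2\<close> on columns with
  \<open>n\<close>.\<close>

lemma incl_sum_extend:
  assumes fin: "finite C1" "finite C2" and n: "n \<notin> \<Union>C1" "n \<notin> \<Union>C2"
  obtains x where
    "\<And>T. n \<notin> T \<Longrightarrow> incl_sum (C1 \<union> insert n ` C2) x T = incl_sum C1 x1 T + incl_sum C2 x2 T"
    "\<And>T. n \<notin> T \<Longrightarrow> incl_sum (C1 \<union> insert n ` C2) x (insert n T) = incl_sum C2 x2 T"
proof
  let ?x = "\<lambda>K. if n \<in> K then x2 (K - {n}) else x1 K"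
  fix T :: "'a set" assume T: "n \<notin> T"
  have inj: "inj_on (insert n) {K \<in> C2. T \<subseteq> K}"
    using n(2) by (intro inj_onI) (metis (no_types, lifting) UnionI insert_ident mem_Collect_eq)
  have "(\<Sum>K\<in>insert n ` {K \<in> C2. T \<subseteq> K}. ?x K) = (\<Sum>K | K \<in> C2 \<and> T \<subseteq> K. ?x (insert n K))"
    by (subst sum.reindex[OF inj]) simp
  also have "\<dots> = incl_sum C2 x2 T"
    using n(2) unfolding incl_sum_def by (intro sum.cong) (auto simp: insert_Diff_if)
  finally have s2: "(\<Sum>K\<in>insert n ` {K \<in> C2. T \<subseteq> K}. ?x K) = incl_sum C2 x2 T" .
  have "{K. K \<in> C1 \<union> insert n ` C2 \<and> insert n T \<subseteq> K} = insert n ` {K \<in> C2. T \<subseteq> K}"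
    using n T by auto
  then show "incl_sum (C1 \<union> insert n ` C2) ?x (insert n T) = incl_sum C2 x2 T"
    using s2 by (simp add: incl_sum_def)
  have s1: "(\<Sum>K | K \<in> C1 \<and> T \<subseteq> K. ?x K) = incl_sum C1 x1 T"
    using n(1) unfolding incl_sum_def by (intro sum.cong) auto
  have "{K. K \<in> C1 \<union> insert n ` C2 \<and> T \<subseteq> K} = {K \<in> C1. T \<subseteq> K} \<union> insert n ` {K \<in> C2. T \<subseteq> K}"
    using T by auto
  then have "incl_sum (C1 \<union> insert n ` C2) ?x T =
      (\<Sum>K | K \<in> C1 \<and> T \<subseteq> K. ?x K) + (\<Sum>K\<in>insert n ` {K \<in> C2. T \<subseteq> K}. ?x K)"
    using fin n(1) by (simp only: incl_sum_def) (rule sum.union_disjoint, auto)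
  then show "incl_sum (C1 \<union> insert n ` C2) ?x T = incl_sum C1 x1 T + incl_sum C2 x2 T"
    using s1 s2 by simp
qed

text \<open>Back substitution: the rows containing \<open>n\<close> involve only \<open>C2\<close>
  and are solved first; \<open>C1\<close> then corrects the rows without \<open>n\<close>.\<close>

lemma solvable_on_extend_lower:
  assumes fin: "finite C1" "finite C2" and n: "n \<notin> \<Union>C1" "n \<notin> \<Union>C2" "n \<notin> \<Union>\<T>0" "n \<notin> \<Union>\<T>1"
    and "solvable_on C1 \<T>0" "solvable_on C2 \<T>1"
  shows "solvable_on (C1 \<union> insert n ` C2) (\<T>0 \<union> insert n ` \<T>1)"
  unfolding solvable_on_def
proof
  fix f :: "'a set \<Rightarrow> int"
  obtain x2 where x2: "\<And>T. T \<in> \<T>1 \<Longrightarrow> incl_sum C2 x2 T = f (insert n T)"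
    using solvable_onD[OF assms(8), of "\<lambda>T. f (insert n T)"] by metis
  obtain x1 where x1: "\<And>T. T \<in> \<T>0 \<Longrightarrow> incl_sum C1 x1 T = f T - incl_sum C2 x2 T"
    using solvable_onD[OF assms(7), of "\<lambda>T. f T - incl_sum C2 x2 T"] by metis
  obtain x where
    "\<And>T. n \<notin> T \<Longrightarrow> incl_sum (C1 \<union> insert n ` C2) x T = incl_sum C1 x1 T + incl_sum C2 x2 T"
    "\<And>T. n \<notin> T \<Longrightarrow> incl_sum (C1 \<union> insert n ` C2) x (insert n T) = incl_sum C2 x2 T"
    using incl_sum_extend[OF fin n(1,2), of x1 x2] by metis
  then show "\<exists>x. \<forall>T\<in>\<T>0 \<union> insert n ` \<T>1. incl_sum (C1 \<union> insert n ` C2) x T = f T"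
    using n(3,4) x1 x2 by (intro exI[of _ x]) auto
qed

text \<open>
  Here the row of \<open>insert n T\<close> is first subtracted from that of \<open>T\<close>, for \<open>T \<in> \<T>1\<close>.
\<close>

lemma solvable_on_extend_upper:
  assumes fin: "finite C1" "finite C2" and n: "n \<notin> \<Union>C1" "n \<notin> \<Union>C2" "n \<notin> \<Union>\<T>0" "n \<notin> \<Union>\<T>1"
    and "solvable_on C1 \<T>1" "solvable_on C2 \<T>0" "\<T>1 \<subseteq> \<T>0"
  shows "solvable_on (C1 \<union> insert n ` C2) (\<T>0 \<union> insert n ` \<T>1)"
  unfolding solvable_on_def
proof
  fix f :: "'a set \<Rightarrow> int"
  obtain x1 where x1: "\<And>T. T \<in> \<T>1 \<Longrightarrow> incl_sum C1 x1 T = f T - f (insert n T)"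
    using solvable_onD[OF assms(7), of "\<lambda>T. f T - f (insert n T)"] by metis
  \<comment> \<open>For \<open>T \<in> \<T>1\<close> the two contributions add up to
    \<open>f T\<close>. For the other rows of \<open>\<T>0\<close> the contribution of
    \<open>x1\<close> is not controlled, so \<open>x2\<close> has to compensate for it.\<close>
  obtain x2 where x2: "\<And>T. T \<in> \<T>0 \<Longrightarrow> incl_sum C2 x2 T =
      (if T \<in> \<T>1 then f (insert n T) else f T - incl_sum C1 x1 T)"
    using solvable_onD[OF assms(8), of
        "\<lambda>T. if T \<in> \<T>1 then f (insert n T) else f T - incl_sum C1 x1 T"] by metis
  obtain x where x:
    "\<And>T. n \<notin> T \<Longrightarrow> incl_sum (C1 \<union> insert n ` C2) x T = incl_sum C1 x1 T + incl_sum C2 x2 T"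
    "\<And>T. n \<notin> T \<Longrightarrow> incl_sum (C1 \<union> insert n ` C2) x (insert n T) = incl_sum C2 x2 T"
    using incl_sum_extend[OF fin n(1,2), of x1 x2] by metis
  have "incl_sum (C1 \<union> insert n ` C2) x T = f T" if "T \<in> \<T>0" for T
    using x(1)[of T] x1[of T] x2[of T] that n(3) by (cases "T \<in> \<T>1") auto
  moreover have "incl_sum (C1 \<union> insert n ` C2) x (insert n T) = f (insert n T)" if "T \<in> \<T>1" for T
    using x(2)[of T] x2[of T] that n(4) assms(9) by auto
  ultimately show "\<exists>x. \<forall>T\<in>\<T>0 \<union> insert n ` \<T>1. incl_sum (C1 \<union> insert n ` C2) x T = f T"
    by (intro exI[of _ x]) auto
qed

section \<open>Ballot sets under adding a point, and the choice of columns\<close>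

text \<open>Deleting the last point keeps the ballot condition. The inclusion can be strict, since
  adjoining \<open>Suc v\<close> may violate the inequality at \<open>Suc v\<close>; solvability on
  the larger family still restricts to the smaller one.\<close>

lemma ballot_sets_Suc_subset:
  "ballot_sets (Suc v) (Suc t) \<subseteq> ballot_sets v (Suc t) \<union> insert (Suc v) ` ballot_sets v t"
proof
  fix T assume T: "T \<in> ballot_sets (Suc v) (Suc t)"
  then have sub: "T \<subseteq> {1..Suc v}" and c: "card T \<le> Suc t"
    and bal: "\<And>x. 2 * card (T \<inter> {1..x}) \<le> x" by (auto simp: ballot_sets_def)
  have fin: "finite T" using sub finite_subset by blast
  have Sv: "{1..Suc v} = insert (Suc v) {1..v}" by auto
  show "T \<in> ballot_sets v (Suc t) \<union> insert (Suc v) ` ballot_sets v t"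
  proof (cases "Suc v \<in> T")
    case False
    then show ?thesis using sub c bal Sv by (auto simp: ballot_sets_def)
  next
    case True
    have "T - {Suc v} \<in> ballot_sets v t"
      unfolding ballot_sets_def
    proof (intro CollectI conjI allI)
      show "T - {Suc v} \<subseteq> {1..v}" using sub Sv by auto
      show "card (T - {Suc v}) \<le> t" using True fin c by simp
      fix x
      have "card ((T - {Suc v}) \<inter> {1..x}) \<le> card (T \<inter> {1..x})" by (intro card_mono) auto
      then show "2 * card ((T - {Suc v}) \<inter> {1..x}) \<le> x" using bal[of x] by linarith
    qed
    then show ?thesis using True by (metis UnI2 imageI insert_Diff)
  qed
qed

lemma ballot_sets_mono: "s \<le> t \<Longrightarrow> ballot_sets v s \<subseteq> ballot_sets v t"
  by (auto simp: ballot_sets_def)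

lemma card_ballot_set: "T \<in> ballot_sets v t \<Longrightarrow> 2 * card T \<le> v"
  unfolding ballot_sets_def by (auto simp: Int_absorb2 dest: spec[of _ v])

lemma not_mem_ballot_sets: "v < n \<Longrightarrow> n \<notin> \<Union>(ballot_sets v t)"
  by (auto simp: ballot_sets_def)

lemma card_extend_family:
  assumes "finite C1" "finite C2" "n \<notin> \<Union>C1" "n \<notin> \<Union>C2"
  shows "card (C1 \<union> insert n ` C2) = card C1 + card C2"
proof -
  have "inj_on (insert n) C2"
    using assms(4) by (intro inj_onI) (metis UnionI insert_ident)
  then have "card (insert n ` C2) = card C2" by (rule card_image)
  moreover have "C1 \<inter> insert n ` C2 = {}" using assms(3) by auto
  ultimately show ?thesis using assms(1,2) by (simp add: card_Un_disjoint)
qed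

text \<open>Induction on \<open>v\<close>, with the column count following Pascal's rule. The
  columns without and with the new point come from smaller instances, whose parameters must again
  satisfy both hypotheses; this dictates the case split.\<close>

lemma solvable_columns_exist:
  assumes "t \<le> k" "k + t \<le> v"
  shows "\<exists>C. C \<subseteq> {K. K \<subseteq> {1..v} \<and> card K = k} \<and> card C = v choose t
    \<and> solvable_on C (ballot_sets v t)"
  using assms
proof (induction v arbitrary: t k)
  case 0
  have "solvable_on {{}} (ballot_sets 0 0)"
    unfolding solvable_on_def
  proof
    fix f :: "nat set \<Rightarrow> int"
    show "\<exists>x. \<forall>T\<in>ballot_sets 0 0. incl_sum {{}} x T = f T"
      by (intro exI[of _ f]) (auto simp: incl_sum_def ballot_sets_def)
  qed
  then show ?case using 0 by (intro exI[of _ "{{}}"]) auto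
next
  case (Suc v)
  show ?case
  proof (cases t)
    case 0
    \<comment> \<open>The only row is that of the empty set, so any single \<open>k\<close>-subset
      serves as column.\<close>
    let ?K = "{1..k}"
    have "solvable_on {?K} (ballot_sets (Suc v) 0)"
      unfolding solvable_on_def
    proof
      fix f :: "nat set \<Rightarrow> int"
      have "T = {}" if "T \<in> ballot_sets (Suc v) 0" for T
        using that finite_subset[of T "{1..Suc v}"] by (auto simp: ballot_sets_def)
      moreover have "incl_sum {?K} (\<lambda>_. f {}) {} = f {}" by (simp add: incl_sum_def)
      ultimately show "\<exists>x. \<forall>T\<in>ballot_sets (Suc v) 0. incl_sum {?K} x T = f T"
        by (metis (no_types))
    qed
    then show ?thesis using 0 Suc.prems by (intro exI[of _ "{?K}"]) auto
  next
    case (Suc s)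
    obtain l where l: "k = Suc l" using Suc Suc.prems by (cases k) auto
    let ?n = "Suc v"
    \<comment> \<open>The two alternatives in \<open>sol\<close> are the two elimination orders:
      \<open>solvable_on_extend_lower\<close> for the first, \<open>solvable_on_extend_upper\<close>
      for the second.\<close>
    have combine: ?thesis
      if C1: "C1 \<subseteq> {K. K \<subseteq> {1..v} \<and> card K = k}" and C2: "C2 \<subseteq> {K. K \<subseteq> {1..v} \<and> card K = l}"
        and c: "card C1 + card C2 = ?n choose t"
        and sol: "solvable_on C1 (ballot_sets v t) \<and> solvable_on C2 (ballot_sets v s) \<or>
          solvable_on C1 (ballot_sets v s) \<and> solvable_on C2 (ballot_sets v t)" for C1 C2
    proof -
      have sub: "C1 \<subseteq> Pow {1..v}" "C2 \<subseteq> Pow {1..v}" using C1 C2 by blast+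
      then have fin: "finite C1" "finite C2"
        using sub finite_subset[of C1 "Pow {1..v}"] finite_subset[of C2 "Pow {1..v}"] by auto
      have n: "?n \<notin> \<Union>C1" "?n \<notin> \<Union>C2"
        using sub by fastforce+
      note nb = not_mem_ballot_sets[OF lessI]
      have "solvable_on (C1 \<union> insert ?n ` C2) (ballot_sets v t \<union> insert ?n ` ballot_sets v s)"
        using sol
      proof
        assume "solvable_on C1 (ballot_sets v t) \<and> solvable_on C2 (ballot_sets v s)"
        then show ?thesis using solvable_on_extend_lower[OF fin n nb nb] by blast
      next
        assume "solvable_on C1 (ballot_sets v s) \<and> solvable_on C2 (ballot_sets v t)"
        then show ?thesis
          using solvable_on_extend_upper[OF fin n nb nb _ _ ballot_sets_mono[of s t]] Suc by simp
      qed
      then have "solvable_on (C1 \<union> insert ?n ` C2) (ballot_sets ?n t)"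
        using ballot_sets_Suc_subset[of v s] Suc by (metis solvable_on_mono)
      moreover have "card (C1 \<union> insert ?n ` C2) = ?n choose t"
        using card_extend_family[OF fin n] c by simp
      moreover have "insert ?n K \<subseteq> {1..?n} \<and> card (insert ?n K) = k" if "K \<in> C2" for K
      proof -
        have K: "K \<subseteq> {1..v}" "card K = l" using that C2 by auto
        then have "finite K" "?n \<notin> K" using finite_subset[of K "{1..v}"] by auto
        then show ?thesis using K l by auto
      qed
      then have "C1 \<union> insert ?n ` C2 \<subseteq> {K. K \<subseteq> {1..?n} \<and> card K = k}"
        using C1 by force
      ultimately show ?thesis by blast
    qed
    have pascal: "?n choose t = (v choose t) + (v choose s)" using Suc by simp
    \<comment> \<open>The first case permits the smaller instances \<open>(t, k)\<close> and
      \<open>(s, l)\<close>, the second \<open>(s, k)\<close> and \<open>(t, l)\<close>. If both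
      fail, then \<open>k + t = ?n\<close> and \<open>t = k\<close>, the boundary case where no
      instance with \<open>t\<close> is available.\<close>
    consider "k + t \<le> v" | "t \<le> l" | "k = t" "2 * t = ?n" using Suc.prems l by linarith
    then show ?thesis
    proof cases
      case 1
      have "t \<le> k" "k + t \<le> v" "s \<le> l" "l + s \<le> v" using 1 Suc.prems Suc l by auto
      then obtain C1 C2 where
        "C1 \<subseteq> {K. K \<subseteq> {1..v} \<and> card K = k}" "card C1 = v choose t"
        "solvable_on C1 (ballot_sets v t)"
        "C2 \<subseteq> {K. K \<subseteq> {1..v} \<and> card K = l}" "card C2 = v choose s"
        "solvable_on C2 (ballot_sets v s)"
        using Suc.IH[of t k] Suc.IH[of s l] by blast
      then show ?thesis using pascal by (intro combine[of C1 C2]) simp_all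
    next
      case 2
      have "s \<le> k" "k + s \<le> v" "t \<le> l" "l + t \<le> v" using 2 Suc.prems Suc l by auto
      then obtain C1 C2 where
        "C1 \<subseteq> {K. K \<subseteq> {1..v} \<and> card K = k}" "card C1 = v choose s"
        "solvable_on C1 (ballot_sets v s)"
        "C2 \<subseteq> {K. K \<subseteq> {1..v} \<and> card K = l}" "card C2 = v choose t"
        "solvable_on C2 (ballot_sets v t)"
        using Suc.IH[of s k] Suc.IH[of t l] by blast
      then show ?thesis using pascal by (intro combine[of C1 C2]) simp_all
    next
      case 3
      have le: "s \<le> k" "k + s \<le> v" "s \<le> l" "l + s \<le> v" using 3 Suc l by auto
      \<comment> \<open>Here \<open>v = 2 * t - 1\<close>, so a ballot set in \<open>{1..v}\<close>
        has fewer than \<open>t\<close> elements. As also \<open>v choose t = v choose s\<close>,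
        instances with \<open>s\<close> can replace those with \<open>t\<close> on both
        sides.\<close>
      have "ballot_sets v t = ballot_sets v s"
      proof
        show "ballot_sets v t \<subseteq> ballot_sets v s"
        proof
          fix T assume T: "T \<in> ballot_sets v t"
          have "card T \<le> s" using card_ballot_set[OF T] 3 Suc by simp
          then show "T \<in> ballot_sets v s" using T by (auto simp: ballot_sets_def)
        qed
      qed (use Suc ballot_sets_mono in auto)
      moreover have "t \<le> v" "v - t = s" using 3 Suc by auto
      then have "v choose t = v choose s" using binomial_symmetric[of t v] by simp
      moreover obtain C1 C2 where
        "C1 \<subseteq> {K. K \<subseteq> {1..v} \<and> card K = k}" "card C1 = v choose s"
        "solvable_on C1 (ballot_sets v s)"
        "C2 \<subseteq> {K. K \<subseteq> {1..v} \<and> card K = l}" "card C2 = v choose s"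
        "solvable_on C2 (ballot_sets v s)"
        using le Suc.IH[of s k] Suc.IH[of s l] by blast
      ultimately show ?thesis using pascal by (intro combine[of C1 C2]) simp_all
    qed
  qed
qed

section \<open>From solvability to the Smith normal form\<close>

lemma unimodular_if_right_inverse:
  assumes "A \<in> carrier_mat n n" "B \<in> carrier_mat n n" "A * B = 1\<^sub>m n"
  shows "unimodular A" "unimodular B"
proof -
  have "det A * det B = 1" using det_mult[OF assms(1,2)] assms(3) by simp
  then have "\<bar>det A\<bar> = 1" "\<bar>det B\<bar> = 1" by (auto simp: zmult_eq_1_iff)
  then show "unimodular A" "unimodular B" using assms by (auto simp: unimodular_def)
qed

text \<open>For two repetition-free listings of the same set this is a permutation matrix; comparing
  list entries avoids naming the index permutation.\<close>

definition relisting_mat :: "'a list \<Rightarrow> 'a list \<Rightarrow> int mat" where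
  "relisting_mat Ks Ls = mat (length Ks) (length Ls) (\<lambda>(i, j). of_bool (Ks ! i = Ls ! j))"

lemma mat_times_relisting_mat:
  assumes "distinct Ks" "set Ls \<subseteq> set Ks"
  shows "mat m (length Ks) (\<lambda>(i, j). g i (Ks ! j)) * relisting_mat Ks Ls
    = mat m (length Ls) (\<lambda>(i, j). g i (Ls ! j))"
proof (rule eq_matI)
  fix i j assume "i < dim_row (mat m (length Ls) (\<lambda>(i, j). g i (Ls ! j)))"
    and "j < dim_col (mat m (length Ls) (\<lambda>(i, j). g i (Ls ! j)))"
  then have ij: "i < m" "j < length Ls" by auto
  then obtain p where p: "p < length Ks" "Ks ! p = Ls ! j"
    using assms(2) by (metis in_set_conv_nth nth_mem subsetD)
  \<comment> \<open>Distinctness of \<open>Ks\<close> leaves only the summand at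
    \<open>p\<close>.\<close>
  have "(\<Sum>q<length Ks. g i (Ks ! q) * of_bool (Ks ! q = Ls ! j))
      = (\<Sum>q<length Ks. if q = p then g i (Ks ! p) else 0)"
    using p assms(1) by (intro sum.cong) (auto simp flip: p(2) simp: nth_eq_iff_index_eq)
  also have "\<dots> = g i (Ls ! j)" using p by simp
  finally show "(mat m (length Ks) (\<lambda>(i, j). g i (Ks ! j)) * relisting_mat Ks Ls) $$ (i, j)
      = mat m (length Ls) (\<lambda>(i, j). g i (Ls ! j)) $$ (i, j)"
    using ij by (simp add: relisting_mat_def scalar_prod_def atLeast0LessThan)
qed (auto simp: relisting_mat_def)

text \<open>The left factor is itself of the form handled by \<open>mat_times_relisting_mat\<close>,
  with \<open>g i L\<close> the indicator of \<open>Ks ! i = L\<close>.\<close>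

lemma relisting_mat_inverse:
  assumes "distinct Ks" "distinct Ls" "set Ks = set Ls"
  shows "relisting_mat Ks Ls * relisting_mat Ls Ks = 1\<^sub>m (length Ks)"
proof -
  have "relisting_mat Ks Ls * relisting_mat Ls Ks
      = mat (length Ks) (length Ks) (\<lambda>(i, j). of_bool (Ks ! i = Ks ! j))"
    using mat_times_relisting_mat[OF assms(2), of Ks "length Ks" "\<lambda>i L. of_bool (Ks ! i = L)"] assms
    by (simp add: relisting_mat_def)
  also have "\<dots> = 1\<^sub>m (length Ks)"
    using assms(1) by (intro eq_matI) (auto simp: nth_eq_iff_index_eq)
  finally show ?thesis .
qed

text \<open>The block triangular \<open>V\<close> below normalises the first block by
  \<open>B\<close> and clears the second, since \<open>M * (- (B * N)) + N = 0\<close>. Its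
  determinant is \<open>det B\<close>, a unit.\<close>

lemma append_cols_elim:
  assumes M: "M \<in> carrier_mat m m" and B: "B \<in> carrier_mat m m" and N: "N \<in> carrier_mat m p"
    and MB: "M * B = 1\<^sub>m m"
  shows "\<exists>V \<in> carrier_mat (m + p) (m + p). unimodular V
    \<and> append_cols M N * V = append_cols (1\<^sub>m m) (0\<^sub>m m p)"
proof -
  define V where "V = four_block_mat B (- (B * N)) (0\<^sub>m p m) (1\<^sub>m p)"
  have BN: "B * N \<in> carrier_mat m p" using B N by simp
  have V: "V \<in> carrier_mat (m + p) (m + p)"
    unfolding V_def using B BN by (intro four_block_carrier_mat) auto
  have "det V = det B * det (1\<^sub>m p)"
    unfolding V_def using B BN by (intro det_four_block_mat_lower_left_zero) auto
  then have "unimodular V"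
    using unimodular_if_right_inverse(2)[OF M B MB] V by (auto simp: unimodular_def)
  moreover have "M * (- (B * N)) + N * 1\<^sub>m p = 0\<^sub>m m p"
  proof -
    have "M * (- (B * N)) = - (M * (B * N))" using M BN by (intro eq_matI) auto
    also have "\<dots> = - N" using assoc_mult_mat[OF M B N] MB N by simp
    finally show ?thesis using N by (simp add: uminus_l_inv_mat)
  qed
  \<comment> \<open>The lower blocks of \<open>append_cols\<close> have \<open>0\<close> rows, so
    block multiplication applies with lower height \<open>0\<close>.\<close>
  then have "append_cols M N * V = append_cols (1\<^sub>m m) (0\<^sub>m m p)"
    unfolding V_def append_cols_def
    using M N B BN MB
    by (subst mult_four_block_mat[of _ m m _ p _ 0]) auto
  ultimately show ?thesis using V by blast
qed

lemma is_smith_normal_form_identity: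
  assumes A: "A \<in> carrier_mat m (m + p)"
    and V: "V \<in> carrier_mat (m + p) (m + p)" "unimodular V"
    and AV: "A * V = append_cols (1\<^sub>m m) (0\<^sub>m m p)"
  shows "is_smith_normal_form A (append_cols (1\<^sub>m m) (0\<^sub>m m p))"
proof -
  have "mat_diag m (\<lambda>_. 1 :: int) = 1\<^sub>m m" by (simp add: mat_diag_def one_mat_def)
  then have "append_cols (1\<^sub>m m) (0\<^sub>m m p) = four_block_mat (mat_diag m (\<lambda>_. 1))
      (0\<^sub>m m (dim_col A - m)) (0\<^sub>m (dim_row A - m) m) (0\<^sub>m (dim_row A - m) (dim_col A - m))"
    using A by (simp add: append_cols_def)
  then have "\<exists>r d. r \<le> dim_row A \<and> r \<le> dim_col A
        \<and> (\<forall>i<r. d i > 0) \<and> (\<forall>i. Suc i < r \<longrightarrow> d i dvd d (Suc i))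
        \<and> append_cols (1\<^sub>m m) (0\<^sub>m m p) = four_block_mat (mat_diag r d) (0\<^sub>m r (dim_col A - r))
                (0\<^sub>m (dim_row A - r) r) (0\<^sub>m (dim_row A - r) (dim_col A - r))"
    using A by (intro exI[of _ m] exI[of _ "\<lambda>_. 1"]) auto
  moreover have "\<exists>U V. U \<in> carrier_mat (dim_row A) (dim_row A) \<and> unimodular U
        \<and> V \<in> carrier_mat (dim_col A) (dim_col A) \<and> unimodular V
        \<and> U * A * V = append_cols (1\<^sub>m m) (0\<^sub>m m p)"
    using A V AV by (intro exI[of _ "1\<^sub>m m"] exI[of _ V]) (auto simp: unimodular_def)
  ultimately show ?thesis unfolding is_smith_normal_form_def by blast
qed

text \<open>Column \<open>j\<close> of \<open>B\<close> solves the system whose right-hand side is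
  the indicator of \<open>R j\<close>. Injectivity of \<open>R\<close> turns these indicators into
  the identity matrix.\<close>

lemma inclusion_mat_right_inverse:
  assumes "distinct Cs" and sol: "solvable_on (set Cs) \<T>"
    and R: "\<And>i. i < m \<Longrightarrow> R i \<in> \<T>" and inj: "inj_on R {..<m}"
  shows "\<exists>B \<in> carrier_mat (length Cs) m.
    mat m (length Cs) (\<lambda>(i, j). if R i \<subseteq> Cs ! j then 1 else 0 :: int) * B = 1\<^sub>m m"
proof -
  have "\<forall>j. \<exists>x. \<forall>T\<in>\<T>. incl_sum (set Cs) x T = of_bool (T = R j)"
    using sol by (simp add: solvable_on_def)
  from choice[OF this]
  obtain x where x: "\<And>j T. T \<in> \<T> \<Longrightarrow> incl_sum (set Cs) (x j) T = of_bool (T = R j)"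
    by blast
  let ?M = "mat m (length Cs) (\<lambda>(i, j). if R i \<subseteq> Cs ! j then 1 else 0 :: int)"
  define B where "B = mat (length Cs) m (\<lambda>(i, j). x j (Cs ! i))"
  have "?M * B = 1\<^sub>m m"
  proof (rule eq_matI)
    fix i j assume "i < dim_row (1\<^sub>m m :: int mat)" "j < dim_col (1\<^sub>m m :: int mat)"
    then have ij: "i < m" "j < m" by auto
    have "(?M * B) $$ (i, j) = (\<Sum>q<length Cs. if R i \<subseteq> Cs ! q then x j (Cs ! q) else 0)"
      using ij by (simp add: B_def scalar_prod_def atLeast0LessThan if_distrib cong: if_cong sum.cong)
        (auto intro!: sum.cong)
    also have "\<dots> = (\<Sum>K\<in>set Cs. if R i \<subseteq> K then x j K else 0)"
      using bij_betw_nth[OF assms(1)] by (intro sum.reindex_bij_betw) auto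
    also have "\<dots> = incl_sum (set Cs) (x j) (R i)"
      by (simp add: incl_sum_def sum.inter_filter)
    also have "\<dots> = 1\<^sub>m m $$ (i, j)"
      using x R ij inj by (auto simp: inj_on_eq_iff)
    finally show "(?M * B) $$ (i, j) = 1\<^sub>m m $$ (i, j)" .
  qed (auto simp: B_def)
  then show ?thesis by (intro bexI[of _ B]) (auto simp: B_def)
qed

section \<open>Applying the solvable columns to the rows given by full-rank parts\<close>

lemma full_rank_part_ballot:
  assumes "T \<subseteq> {1..v}" "card T = t"
  shows "full_rank_part T \<in> ballot_sets v t"
proof -
  have fin: "finite T" using assms finite_subset by blast
  moreover have "card (full_rank_part T) \<le> t"
    using assms fin full_rank_part_subset card_mono by metis
  ultimately show ?thesis
    using assms full_rank_part_subset[of T] full_rank_ballot[OF _ full_rank_full_rank_part, of T]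
      finite_subset[OF full_rank_part_subset fin]
    by (auto simp: ballot_sets_def)
qed

lemma length_enumerates_subsets:
  assumes "enumerates_subsets Xs s v"
  shows "length Xs = v choose s"
proof -
  have "length Xs = card {X. X \<subseteq> {1..v} \<and> card X = s}"
    using assms by (metis distinct_card enumerates_subsets_def)
  then show ?thesis using n_subsets[of "{1..v}" s] by simp
qed

theorem theorem4p1:
  fixes t k v :: nat and Ts Ks :: "nat set list"
  assumes "t \<le> k" and "k + t \<le> v"
    and "enumerates_subsets Ts t v" and "enumerates_subsets Ks k v"
  shows "is_smith_normal_form (W_bar Ts Ks)
    (append_cols (1\<^sub>m (v choose t)) (0\<^sub>m (v choose t) ((v choose k) - (v choose t))))"
proof -
  obtain C where C: "C \<subseteq> {K. K \<subseteq> {1..v} \<and> card K = k}" "card C = v choose t"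
    and sol: "solvable_on C (ballot_sets v t)"
    using solvable_columns_exist[OF assms(1,2)] by blast
  have Ts: "distinct Ts" "set Ts = {X. X \<subseteq> {1..v} \<and> card X = t}" "length Ts = v choose t"
    and Ks: "distinct Ks" "set Ks = {X. X \<subseteq> {1..v} \<and> card X = k}" "length Ks = v choose k"
    using assms(3,4) length_enumerates_subsets by (auto simp: enumerates_subsets_def)
  define Cs where "Cs = filter (\<lambda>K. K \<in> C) Ks"
  define Ds where "Ds = filter (\<lambda>K. K \<notin> C) Ks"
  define m where "m = v choose t"
  define p where "p = length Ds"
  define g :: "nat \<Rightarrow> nat set \<Rightarrow> int" where
    "g i K = (if full_rank_part (Ts ! i) \<subseteq> K then 1 else 0)" for i K
  have Cs: "distinct Cs" "set Cs = C" using Ks C by (auto simp: Cs_def)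
  \<comment> \<open>There are exactly as many chosen columns as rows, so \<open>M\<close> is square
    and its integer right inverse is unimodular.\<close>
  have lC: "length Cs = m" using distinct_card[OF Cs(1)] Cs C by (simp add: m_def)
  have lK: "length Ks = m + p"
    using sum_length_filter_compl[of "\<lambda>K. K \<in> C" Ks] lC by (simp add: Cs_def Ds_def p_def)
  have CD: "distinct (Cs @ Ds)" "set (Cs @ Ds) = set Ks" using Ks by (auto simp: Cs_def Ds_def)
  have mem: "Ts ! i \<in> set Ts" if "i < m" for i using that Ts(3) by (simp add: m_def)
  have R: "full_rank_part (Ts ! i) \<in> ballot_sets v t" if "i < m" for i
    using mem[OF that] Ts(2) full_rank_part_ballot by auto
  have inj: "inj_on (\<lambda>i. full_rank_part (Ts ! i)) {..<m}"
  proof (rule inj_onI)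
    fix i j assume ij: "i \<in> {..<m}" "j \<in> {..<m}"
      and eq: "full_rank_part (Ts ! i) = full_rank_part (Ts ! j)"
    have sub: "Ts ! i \<subseteq> {1..v}" "Ts ! j \<subseteq> {1..v}" and "card (Ts ! i) = card (Ts ! j)"
      using mem ij Ts(2) by auto
    then have "Ts ! i = Ts ! j"
      using sub[THEN finite_subset] by (intro full_rank_part_inj[OF _ _ _ _ _ eq]) auto
    then show "i = j" using ij Ts by (simp add: nth_eq_iff_index_eq m_def)
  qed
  define M where "M = mat m m (\<lambda>(i, j). g i (Cs ! j))"
  define N where "N = mat m p (\<lambda>(i, j). g i (Ds ! j))"
  have MN: "M \<in> carrier_mat m m" "N \<in> carrier_mat m p" by (auto simp: M_def N_def)
  obtain B where B: "B \<in> carrier_mat m m" "M * B = 1\<^sub>m m"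
    using inclusion_mat_right_inverse[OF Cs(1), of "ballot_sets v t" m, OF _ R inj] sol Cs lC
    by (auto simp: M_def g_def)
  obtain V where V: "V \<in> carrier_mat (m + p) (m + p)" "unimodular V"
    "append_cols M N * V = append_cols (1\<^sub>m m) (0\<^sub>m m p)"
    using append_cols_elim[OF MN(1) B(1) MN(2) B(2)] by blast
  \<comment> \<open>Reorders the columns so that the chosen ones come first; \<open>V\<close> then
    eliminates the rest.\<close>
  define Q where "Q = relisting_mat Ks (Cs @ Ds)"
  have Q: "Q \<in> carrier_mat (m + p) (m + p)"
    using lK lC by (auto simp: Q_def relisting_mat_def p_def)
  have "relisting_mat (Cs @ Ds) Ks \<in> carrier_mat (m + p) (m + p)"
    using lK lC by (auto simp: relisting_mat_def p_def)
  then have uQ: "unimodular Q"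
    using unimodular_if_right_inverse(1)[OF Q] relisting_mat_inverse[OF Ks(1) CD(1)] CD(2) lK
    by (simp add: Q_def)
  have W: "W_bar Ts Ks = mat m (length Ks) (\<lambda>(i, j). g i (Ks ! j))"
    using Ts by (simp add: W_bar_def g_def m_def)
  then have Wc: "W_bar Ts Ks \<in> carrier_mat m (m + p)" using lK by simp
  have "W_bar Ts Ks * Q = mat m (length (Cs @ Ds)) (\<lambda>(i, j). g i ((Cs @ Ds) ! j))"
    unfolding W Q_def using Ks(1) CD(2) by (intro mat_times_relisting_mat) auto
  also have "\<dots> = append_cols M N"
    using lC by (intro eq_matI) (auto simp: append_cols_def M_def N_def p_def nth_append)
  finally have "W_bar Ts Ks * (Q * V) = append_cols (1\<^sub>m m) (0\<^sub>m m p)"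
    using V assoc_mult_mat[OF Wc Q V(1)] by simp
  moreover have "unimodular (Q * V)"
    using Q V uQ det_mult[OF Q V(1)] by (auto simp: unimodular_def abs_mult)
  ultimately have "is_smith_normal_form (W_bar Ts Ks) (append_cols (1\<^sub>m m) (0\<^sub>m m p))"
    using Q V(1) by (intro is_smith_normal_form_identity[OF Wc]) auto
  moreover have "p = (v choose k) - (v choose t)" using lK Ks by (simp add: m_def)
  ultimately show ?thesis by (simp add: m_def)
qed

end
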